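(* Let $\triangle ABC$ be a triangle and let $A_1,A_2$ on the line $BC$, $B_1,B_2$ on the line $CA$, $C_1,C_2$ on the line $AB$ be six points lying on the same conic $\mathcal{C}$. Let $X_1 = AA_1\cap BB_1$, $X_2 = BB_1\cap CC_1$, $X_3 = CC_1\cap AA_1$, and $Y_1 = AA_2\cap BB_2$, $Y_2 = BB_2\cap CC_2$, $Y_3 = CC_2\cap AA_2$. Then the points $X_1$, $X_2$, $X_3$, $Y_1$, $Y_2$ and $Y_3$ lie on the same conic.
   Context: The setting is the real projective plane (containing the Euclidean plane). The six points $A_1,A_2,B_1,B_2,C_1,C_2$ are distinct and different from the vertices $A,B,C$. The symbol $PQ\cap RS$ denotes the intersection point of the lines $PQ$ and $RS$. A conic is the zero locus of a nonzero quadratic form in homogeneous coordinates (degenerate conics are allowed). *)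

theory Defs
  imports "HOL-Analysis.Analysis"
begin

text \<open>A point of the real projective plane is a one-dimensional linear subspace of
  \<open>real^3\<close>; the nonzero elements of that subspace are the homogeneous coordinate
  vectors of the point.\<close>

typedef proj_point = "{L :: (real^3) set. subspace L \<and> dim L = 1}"
  morphisms hcoords Proj_Point
proof
  show "span {axis 1 1} \<in> {L :: (real^3) set. subspace L \<and> dim L = 1}"
    by (simp add: dim_insert)
qed

text \<open>The line \<open>PQ\<close>. This is a projective line only for \<open>P \<noteq> Q\<close>; for \<open>P = Q\<close> the set
  is the singleton of \<open>P\<close>.\<close>

definition line_through :: "proj_point \<Rightarrow> proj_point \<Rightarrow> proj_point set" where
  "line_through P Q = {R. hcoords R \<subseteq> span (hcoords P \<union> hcoords Q)}"

text \<open>The point \<open>PQ \<inter> RS\<close>; meaningful only if the two lines have exactly one common point.\<close>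

definition meet :: "proj_point \<Rightarrow> proj_point \<Rightarrow> proj_point \<Rightarrow> proj_point \<Rightarrow> proj_point" where
  "meet P Q R S = (THE X. X \<in> line_through P Q \<inter> line_through R S)"

definition is_triangle :: "proj_point \<Rightarrow> proj_point \<Rightarrow> proj_point \<Rightarrow> bool" where
  "is_triangle A B C \<longleftrightarrow> \<not> (\<exists>P Q. P \<noteq> Q \<and> {A, B, C} \<subseteq> line_through P Q)"

definition ternary_quadratic_form :: "(real^3 \<Rightarrow> real) \<Rightarrow> bool" where
  "ternary_quadratic_form q \<longleftrightarrow>
    (\<exists>a b c d e f. \<forall>v. q v = a * (v$1)\<^sup>2 + b * (v$2)\<^sup>2 + c * (v$3)\<^sup>2
                           + d * (v$1) * (v$2) + e * (v$2) * (v$3) + f * (v$3) * (v$1))"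

text \<open>Degenerate conics are allowed. Over the reals a quadratic form that is not the zero
  function is the same as one with a nonzero coefficient.\<close>

definition is_conic :: "proj_point set \<Rightarrow> bool" where
  "is_conic K \<longleftrightarrow>
    (\<exists>q. ternary_quadratic_form q \<and> (\<exists>v. q v \<noteq> 0) \<and> K = {P. \<forall>v\<in>hcoords P. q v = 0})"

end

theory Submission
  imports Defs
begin

text \<open>Let \<open>a\<close>, \<open>b\<close>, \<open>c\<close> be homogeneous coordinate vectors of \<open>A\<close>, \<open>B\<close>, \<open>C\<close>. They form a basis
  (\<open>triangle_independent\<close>), and the six given points are \<open>b + p c\<close>, \<open>c + q a\<close>, \<open>a + r b\<close> and
  \<open>b + p' c\<close>, \<open>c + q' a\<close>, \<open>a + r' b\<close> with all six parameters nonzero. Restricted to the side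
  \<open>BC\<close>, the equation of the given conic is a binary quadratic form with roots \<open>p\<close> and \<open>p'\<close>, so
  Vieta's formula expresses \<open>p p'\<close> as a quotient of two diagonal coefficients. Multiplying over
  the three sides gives \<open>p p' q q' r r' = 1\<close> (\<open>carnot_product\<close>), which is Carnot's theorem.

  In these coordinates the cevians \<open>AA\<^sub>1\<close>, \<open>BB\<^sub>1\<close>, \<open>CC\<^sub>1\<close> have the equations \<open>z = p y\<close>,
  \<open>x = q z\<close>, \<open>y = r x\<close>. The conics through their pairwise intersections \<open>X\<^sub>1\<close>, \<open>X\<^sub>2\<close>, \<open>X\<^sub>3\<close>
  include all combinations of the pairwise products of these three linear forms, and
  similarly for the second triangle. A conic through all six points is therefore obtained if a
  combination of the first kind coincides with one of the second kind. Comparing the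
  coefficients of the squares fixes the second combination in terms of the first; comparing
  the mixed coefficients then leaves a homogeneous \<open>3\<close> by \<open>3\<close> system, whose determinant is
  \<open>(p' - p) (q' - q) (r' - r) (1 - p p' q q' r r')\<close>. By Carnot's relation it has a nontrivial
  solution (\<open>common_circumconic\<close>).\<close>

section \<open>Coordinate vectors of points\<close>

definition represents :: "real^3 \<Rightarrow> proj_point \<Rightarrow> bool" where
  "represents w P \<longleftrightarrow> w \<noteq> 0 \<and> hcoords P = span {w}"

lemma representsE:
  obtains w where "represents w P"
proof -
  have P: "subspace (hcoords P)" "dim (hcoords P) = 1"
    using hcoords[of P] by auto
  obtain B where B: "B \<subseteq> hcoords P" "independent B" "hcoords P \<subseteq> span B"
    "card B = dim (hcoords P)"
    using basis_exists by blast
  then obtain w where w: "B = {w}"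
    using P card_1_singletonE by metis
  have "w \<noteq> 0"
    using B(2) w dependent_zero by blast
  moreover have "span {w} = hcoords P"
    using B w P(1) by (metis span_minimal subset_antisym)
  ultimately show thesis
    using that unfolding represents_def by metis
qed

lemma represented_point_exists:
  assumes "w \<noteq> 0"
  obtains P where "represents w P"
proof -
  have "subspace (span {w}) \<and> dim (span {w}) = 1"
    using assms by (simp add: dim_insert)
  then have "hcoords (Proj_Point (span {w})) = span {w}"
    using Proj_Point_inverse by auto
  then show thesis
    using that assms unfolding represents_def by blast
qed

lemma represents_scale:
  assumes "represents w P" "k \<noteq> 0"
  shows "represents (k *\<^sub>R w) P"
  using assms span_image_scale[of "{w}" "\<lambda>_. k"] unfolding represents_def by simp

lemma represents_unique:
  assumes "represents w P" "represents w Q"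
  shows "P = Q"
  using assms unfolding represents_def by (metis hcoords_inject)

lemma line_through_iff:
  assumes "represents p P" "represents q Q" "represents r R"
  shows "R \<in> line_through P Q \<longleftrightarrow> (\<exists>x y. r = x *\<^sub>R p + y *\<^sub>R q)"
proof -
  have "span (span {p} \<union> span {q}) = span {p, q}"
  proof (rule span_unique)
    show "span {p} \<union> span {q} \<subseteq> span {p, q}"
      by (simp add: span_mono)
    show "span {p, q} \<subseteq> S" if "span {p} \<union> span {q} \<subseteq> S" "subspace S" for S
      using that by (intro span_minimal) (auto intro: span_base)
  qed (rule subspace_span)
  moreover have "span {r} \<subseteq> span {p, q} \<longleftrightarrow> r \<in> span {p, q}"
    using span_base[of r "{r}"] span_minimal[of "{r}" "span {p, q}"] by auto
  moreover have "r \<in> span {p, q} \<longleftrightarrow> (\<exists>x y. r = x *\<^sub>R p + y *\<^sub>R q)"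
    by (simp add: span_breakdown_eq span_singleton image_iff diff_eq_eq add.commute)
  ultimately show ?thesis
    using assms unfolding line_through_def represents_def by auto
qed

definition independent3 :: "real^3 \<Rightarrow> real^3 \<Rightarrow> real^3 \<Rightarrow> bool" where
  "independent3 a b c \<longleftrightarrow>
    (\<forall>x y z. x *\<^sub>R a + y *\<^sub>R b + z *\<^sub>R c = 0 \<longrightarrow> x = 0 \<and> y = 0 \<and> z = 0)"

lemma independent3_rotate:
  assumes "independent3 a b c"
  shows "independent3 b c a"
  unfolding independent3_def
proof (intro allI impI)
  fix x y z
  assume "x *\<^sub>R b + y *\<^sub>R c + z *\<^sub>R a = 0"
  then have "z *\<^sub>R a + x *\<^sub>R b + y *\<^sub>R c = 0"
    by (simp add: add_ac)
  then show "x = 0 \<and> y = 0 \<and> z = 0"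
    using assms unfolding independent3_def by blast
qed

lemma independent3_coeffs:
  assumes "independent3 a b c"
    and "x *\<^sub>R a + y *\<^sub>R b + z *\<^sub>R c = x' *\<^sub>R a + y' *\<^sub>R b + z' *\<^sub>R c"
  shows "x = x'" "y = y'" "z = z'"
proof -
  have "(x - x') *\<^sub>R a + (y - y') *\<^sub>R b + (z - z') *\<^sub>R c = 0"
    using assms(2) by (simp add: algebra_simps)
  then show "x = x'" "y = y'" "z = z'"
    using assms(1) unfolding independent3_def by (metis right_minus_eq)+
qed

lemma ex_distinct_point: "\<exists>Q. Q \<noteq> (P :: proj_point)"
proof -
  obtain U V where U: "represents (axis 1 1) U" and V: "represents (axis 2 1) V"
    by (metis axis_eq_0_iff represented_point_exists zero_neq_one)
  have "axis 2 (1::real) \<notin> span {axis 1 1 :: real^3}"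
    by (auto simp: span_singleton vec_eq_iff axis_def forall_3)
  then have "U \<noteq> V"
    using U V unfolding represents_def by (metis insertI1 span_base)
  then show ?thesis
    by metis
qed

lemma triangle_vertices_distinct:
  assumes "is_triangle A B C"
  shows "A \<noteq> B"
proof
  assume "A = B"
  \<comment> \<open>A line is spanned by two distinct points, so an auxiliary point is needed if all three
    vertices coincide.\<close>
  obtain D where D: "D \<noteq> A" "C = A \<or> C = D"
    using ex_distinct_point[of A] by metis
  have "{A, B, C} \<subseteq> line_through A D"
    using D \<open>A = B\<close> unfolding line_through_def by (auto intro: span_base)
  then show False
    using assms D unfolding is_triangle_def by metis
qed

lemma triangle_independent:
  assumes "is_triangle A B C" "represents a A" "represents b B" "represents c C"
  shows "independent3 a b c"
proof -
  have ne: "a \<noteq> 0" "b \<noteq> 0"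
    using assms unfolding represents_def by auto
  have AB: "A \<noteq> B"
    using assms triangle_vertices_distinct by blast
  have "A \<in> line_through A B" "B \<in> line_through A B"
    unfolding line_through_def by (auto intro: span_base)
  then have "C \<notin> line_through A B"
    using assms(1) AB unfolding is_triangle_def by auto
  then have c: "c \<noteq> x *\<^sub>R a + y *\<^sub>R b" for x y
    using line_through_iff[OF assms(2-4)] by auto
  have b: "b \<noteq> k *\<^sub>R a" for k
    using represents_scale[OF assms(2), of k] represents_unique assms(3) AB ne(2)
    by (metis scaleR_zero_left)
  show ?thesis
    unfolding independent3_def
  proof (intro allI impI)
    fix x y z
    assume eq: "x *\<^sub>R a + y *\<^sub>R b + z *\<^sub>R c = 0"
    have z: "z = 0"
    proof (rule ccontr)
      assume "z \<noteq> 0"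
      have "z *\<^sub>R c = (- x) *\<^sub>R a + (- y) *\<^sub>R b"
        using eq by (simp add: algebra_simps eq_neg_iff_add_eq_0)
      then have "(1 / z) *\<^sub>R (z *\<^sub>R c) = (1 / z) *\<^sub>R ((- x) *\<^sub>R a + (- y) *\<^sub>R b)"
        by simp
      then have "c = (- x / z) *\<^sub>R a + (- y / z) *\<^sub>R b"
        using \<open>z \<noteq> 0\<close> by (simp add: algebra_simps)
      then show False
        using c by blast
    qed
    have y: "y = 0"
    proof (rule ccontr)
      assume "y \<noteq> 0"
      have "y *\<^sub>R b = (- x) *\<^sub>R a"
        using eq z by (simp add: eq_neg_iff_add_eq_0 add.commute)
      then have "(1 / y) *\<^sub>R (y *\<^sub>R b) = (1 / y) *\<^sub>R ((- x) *\<^sub>R a)"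
        by simp
      then have "b = (- x / y) *\<^sub>R a"
        using \<open>y \<noteq> 0\<close> by simp
      then show False
        using b by blast
    qed
    show "x = 0 \<and> y = 0 \<and> z = 0"
      using eq y z ne by simp
  qed
qed

text \<open>A basis \<open>a\<close>, \<open>b\<close>, \<open>c\<close> of \<open>\<real>\<^sup>3\<close> provides a linear coordinate map, which transports
  forms in the coordinates \<open>x\<close>, \<open>y\<close>, \<open>z\<close> to forms on \<open>\<real>\<^sup>3\<close>.\<close>

lemma coordinate_map:
  assumes "independent3 a b c"
  obtains S :: "real^3 \<Rightarrow> real^3"
  where "linear S"
    and "\<And>x y z. S (x *\<^sub>R a + y *\<^sub>R b + z *\<^sub>R c) = vector [x, y, z]"
    and "\<And>v. v = (S v $ 1) *\<^sub>R a + (S v $ 2) *\<^sub>R b + (S v $ 3) *\<^sub>R c"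
proof -
  define T :: "real^3 \<Rightarrow> real^3"
    where "T v = (v$1) *\<^sub>R a + (v$2) *\<^sub>R b + (v$3) *\<^sub>R c" for v
  have lin: "linear T"
    by (rule linearI) (simp_all add: T_def algebra_simps)
  have "inj T"
  proof (rule injI)
    fix u v
    assume "T u = T v"
    then have "u$1 = v$1" "u$2 = v$2" "u$3 = v$3"
      using independent3_coeffs[OF assms] unfolding T_def by blast+
    then show "u = v"
      by (simp add: vec_eq_iff forall_3)
  qed
  then obtain S where S: "linear S" "\<And>v. S (T v) = v" "\<And>v. T (S v) = v"
    using linear_injective_isomorphism[OF lin] by metis
  have "S (x *\<^sub>R a + y *\<^sub>R b + z *\<^sub>R c) = vector [x, y, z]" for x y z
    using S(2)[of "vector [x, y, z]"] by (simp add: T_def)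
  moreover have "v = (S v $ 1) *\<^sub>R a + (S v $ 2) *\<^sub>R b + (S v $ 3) *\<^sub>R c" for v
    using S(3)[of v] by (simp add: T_def)
  ultimately show thesis
    using that S(1) by blast
qed

section \<open>Ternary quadratic forms\<close>

lemma linear_functional_components:
  assumes "linear (f :: real^3 \<Rightarrow> real)"
  shows "f v = v$1 * f (axis 1 1) + v$2 * f (axis 2 1) + v$3 * f (axis 3 1)"
proof -
  have "v = v$1 *\<^sub>R axis 1 1 + v$2 *\<^sub>R axis 2 1 + v$3 *\<^sub>R axis 3 1"
    by (simp add: vec_eq_iff forall_3 axis_def)
  then have "f v = f (v$1 *\<^sub>R axis 1 1 + v$2 *\<^sub>R axis 2 1 + v$3 *\<^sub>R axis 3 1)"
    by simp
  then show ?thesis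
    using assms by (simp add: linear_add linear_cmul)
qed

lemma ternary_quadratic_form_mult:
  assumes "linear (f :: real^3 \<Rightarrow> real)" "linear (g :: real^3 \<Rightarrow> real)"
  shows "ternary_quadratic_form (\<lambda>v. f v * g v)"
proof -
  define f1 f2 f3 where "f1 = f (axis 1 1)" "f2 = f (axis 2 1)" "f3 = f (axis 3 1)"
  define g1 g2 g3 where "g1 = g (axis 1 1)" "g2 = g (axis 2 1)" "g3 = g (axis 3 1)"
  have "f v * g v = f1 * g1 * (v$1)\<^sup>2 + f2 * g2 * (v$2)\<^sup>2 + f3 * g3 * (v$3)\<^sup>2
      + (f1 * g2 + f2 * g1) * (v$1) * (v$2) + (f2 * g3 + f3 * g2) * (v$2) * (v$3)
      + (f3 * g1 + f1 * g3) * (v$3) * (v$1)" for v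
    unfolding linear_functional_components[OF assms(1), of v]
      linear_functional_components[OF assms(2), of v] f1_f2_f3_def g1_g2_g3_def
    by (simp add: power2_eq_square algebra_simps)
  then show ?thesis
    unfolding ternary_quadratic_form_def by blast
qed

lemma ternary_quadratic_form_add:
  assumes "ternary_quadratic_form f" "ternary_quadratic_form g"
  shows "ternary_quadratic_form (\<lambda>v. f v + g v)"
proof -
  obtain a b c d e h where f: "\<And>v. f v = a * (v$1)\<^sup>2 + b * (v$2)\<^sup>2 + c * (v$3)\<^sup>2
      + d * (v$1) * (v$2) + e * (v$2) * (v$3) + h * (v$3) * (v$1)"
    using assms(1) unfolding ternary_quadratic_form_def by metis
  obtain a' b' c' d' e' h' where g: "\<And>v. g v = a' * (v$1)\<^sup>2 + b' * (v$2)\<^sup>2 + c' * (v$3)\<^sup>2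
      + d' * (v$1) * (v$2) + e' * (v$2) * (v$3) + h' * (v$3) * (v$1)"
    using assms(2) unfolding ternary_quadratic_form_def by metis
  have "f v + g v = (a + a') * (v$1)\<^sup>2 + (b + b') * (v$2)\<^sup>2 + (c + c') * (v$3)\<^sup>2
      + (d + d') * (v$1) * (v$2) + (e + e') * (v$2) * (v$3) + (h + h') * (v$3) * (v$1)" for v
    by (simp add: f g algebra_simps)
  then show ?thesis
    unfolding ternary_quadratic_form_def by blast
qed

lemma ternary_quadratic_form_on_span:
  assumes "ternary_quadratic_form f"
  obtains \<alpha> \<beta> \<gamma> \<delta> \<epsilon> \<zeta> where "\<And>x y z. f (x *\<^sub>R a + y *\<^sub>R b + z *\<^sub>R c)
    = \<alpha> * x\<^sup>2 + \<beta> * y\<^sup>2 + \<gamma> * z\<^sup>2 + \<delta> * y * z + \<epsilon> * z * x + \<zeta> * x * y"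
proof -
  obtain k1 k2 k3 k12 k23 k31 where f: "\<And>v. f v = k1 * (v$1)\<^sup>2 + k2 * (v$2)\<^sup>2 + k3 * (v$3)\<^sup>2
      + k12 * (v$1) * (v$2) + k23 * (v$2) * (v$3) + k31 * (v$3) * (v$1)"
    using assms unfolding ternary_quadratic_form_def by metis
  \<comment> \<open>The mixed coefficients are values of the polar bilinear form of \<open>f\<close>.\<close>
  define polar where "polar u v = 2 * k1 * u$1 * v$1 + 2 * k2 * u$2 * v$2 + 2 * k3 * u$3 * v$3
    + k12 * (u$1 * v$2 + u$2 * v$1) + k23 * (u$2 * v$3 + u$3 * v$2)
    + k31 * (u$3 * v$1 + u$1 * v$3)" for u v :: "real^3"
  have "f (x *\<^sub>R a + y *\<^sub>R b + z *\<^sub>R c) = f a * x\<^sup>2 + f b * y\<^sup>2 + f c * z\<^sup>2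
      + polar b c * y * z + polar c a * z * x + polar a b * x * y" for x y z
    by (simp add: f polar_def power2_eq_square algebra_simps)
  then show thesis
    using that by blast
qed

lemma ternary_quadratic_form_scale:
  assumes "ternary_quadratic_form f"
  shows "f (k *\<^sub>R v) = k\<^sup>2 * f v"
proof -
  obtain k1 k2 k3 k12 k23 k31 where f: "\<And>v. f v = k1 * (v$1)\<^sup>2 + k2 * (v$2)\<^sup>2 + k3 * (v$3)\<^sup>2
      + k12 * (v$1) * (v$2) + k23 * (v$2) * (v$3) + k31 * (v$3) * (v$1)"
    using assms unfolding ternary_quadratic_form_def by metis
  show ?thesis
    by (simp add: f power2_eq_square algebra_simps)
qed

lemma represents_in_conic_iff:
  assumes "ternary_quadratic_form f" "represents w P"
  shows "(\<forall>v\<in>hcoords P. f v = 0) \<longleftrightarrow> f w = 0"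
  using assms ternary_quadratic_form_scale[OF assms(1)] span_base[of w "{w}"]
  unfolding represents_def by (auto simp: span_singleton)

section \<open>Cevians in coordinates\<close>

text \<open>Excluding \<open>C\<close> allows the coefficient of \<open>b\<close> to be normalised to \<open>1\<close>; excluding \<open>B\<close> makes
  the parameter nonzero.\<close>

lemma side_point_parameter:
  assumes "represents b B" "represents c C" "P \<in> line_through B C" "P \<noteq> B" "P \<noteq> C"
  obtains p where "p \<noteq> 0" "represents (b + p *\<^sub>R c) P"
proof -
  obtain w where w: "represents w P"
    using representsE by blast
  then obtain x y where xy: "w = x *\<^sub>R b + y *\<^sub>R c"
    using line_through_iff assms by blast
  have w0: "w \<noteq> 0"
    using w unfolding represents_def by simp
  have x: "x \<noteq> 0"
  proof
    assume "x = 0"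
    then have "represents w C"
      using represents_scale[OF assms(2), of y] w0 xy by auto
    then show False
      using represents_unique w assms by blast
  qed
  have y: "y \<noteq> 0"
  proof
    assume "y = 0"
    then have "represents w B"
      using represents_scale[OF assms(1), of x] w0 xy by auto
    then show False
      using represents_unique w assms by blast
  qed
  have "(1 / x) *\<^sub>R w = b + (y / x) *\<^sub>R c"
    using x xy by (simp add: scaleR_add_right)
  then have "represents (b + (y / x) *\<^sub>R c) P"
    using represents_scale[OF w, of "1 / x"] x by simp
  then show thesis
    using that[of "y / x"] x y by simp
qed

lemma meet_cevians:
  assumes ind: "independent3 a b c"
    and rep: "represents a A" "represents b B"
    and A1: "represents (b + p *\<^sub>R c) A1" and B1: "represents (c + q *\<^sub>R a) B1"
  shows "represents ((p * q) *\<^sub>R a + b + p *\<^sub>R c) (meet A A1 B B1)"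
proof -
  let ?w = "(p * q) *\<^sub>R a + b + p *\<^sub>R c"
  have "?w \<noteq> 0"
    using independent3_coeffs(2)[OF ind, of "p * q" 1 p 0 0 0] by auto
  then obtain X where X: "represents ?w X"
    using represented_point_exists by blast
  have "?w = (p * q) *\<^sub>R a + 1 *\<^sub>R (b + p *\<^sub>R c)" "?w = 1 *\<^sub>R b + p *\<^sub>R (c + q *\<^sub>R a)"
    by (simp_all add: algebra_simps)
  then have on: "X \<in> line_through A A1 \<inter> line_through B B1"
    using line_through_iff[OF rep(1) A1 X] line_through_iff[OF rep(2) B1 X] by blast
  have uniq: "Y = X" if Y: "Y \<in> line_through A A1 \<inter> line_through B B1" for Y
  proof -
    obtain v where v: "represents v Y"
      using representsE by blast
    obtain s t where st: "v = s *\<^sub>R a + t *\<^sub>R (b + p *\<^sub>R c)"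
      using line_through_iff[OF rep(1) A1 v] Y by blast
    obtain s' t' where st': "v = s' *\<^sub>R b + t' *\<^sub>R (c + q *\<^sub>R a)"
      using line_through_iff[OF rep(2) B1 v] Y by blast
    have "s *\<^sub>R a + t *\<^sub>R b + (t * p) *\<^sub>R c = (t' * q) *\<^sub>R a + s' *\<^sub>R b + t' *\<^sub>R c"
      using st st' by (simp add: algebra_simps)
    then have "s = t * (p * q)"
      using independent3_coeffs[OF ind] by (metis mult.assoc)
    then have vw: "v = t *\<^sub>R ?w"
      using st by (simp add: algebra_simps)
    then have "t \<noteq> 0"
      using v unfolding represents_def by auto
    then have "represents v X"
      using represents_scale[OF X] vw by simp
    then show ?thesis
      using represents_unique v by blast
  qed
  have "meet A A1 B B1 = X"
    unfolding meet_def using on uniq by (rule the_equality)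
  then show ?thesis
    using X by simp
qed

text \<open>The other two intersections follow from \<open>meet_cevians\<close> by rotating the triangle.\<close>

lemma cevian_triangle:
  assumes ind: "independent3 a b c"
    and rep: "represents a A" "represents b B" "represents c C"
    and A1: "represents (b + p *\<^sub>R c) A1" and B1: "represents (c + q *\<^sub>R a) B1"
    and C1: "represents (a + r *\<^sub>R b) C1"
  shows "represents ((p * q) *\<^sub>R a + 1 *\<^sub>R b + p *\<^sub>R c) (meet A A1 B B1)"
    and "represents (q *\<^sub>R a + (q * r) *\<^sub>R b + 1 *\<^sub>R c) (meet B B1 C C1)"
    and "represents (1 *\<^sub>R a + r *\<^sub>R b + (r * p) *\<^sub>R c) (meet C C1 A A1)"
proof -
  have ind': "independent3 b c a" "independent3 c a b"
    using ind independent3_rotate by blast+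
  show "represents ((p * q) *\<^sub>R a + 1 *\<^sub>R b + p *\<^sub>R c) (meet A A1 B B1)"
    using meet_cevians[OF ind rep(1,2) A1 B1] by simp
  show "represents (q *\<^sub>R a + (q * r) *\<^sub>R b + 1 *\<^sub>R c) (meet B B1 C C1)"
    using meet_cevians[OF ind'(1) rep(2,3) B1 C1] by (simp add: add_ac)
  show "represents (1 *\<^sub>R a + r *\<^sub>R b + (r * p) *\<^sub>R c) (meet C C1 A A1)"
    using meet_cevians[OF ind'(2) rep(3,1) C1 A1] by (simp add: add_ac)
qed

section \<open>Carnot's relation and the second conic\<close>

lemma vieta_product:
  fixes \<beta> \<gamma> \<delta> p p' :: real
  assumes "\<beta> + \<delta> * p + \<gamma> * p\<^sup>2 = 0" "\<beta> + \<delta> * p' + \<gamma> * p'\<^sup>2 = 0" "p \<noteq> p'"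
  shows "\<beta> = \<gamma> * (p * p')" "\<delta> = - \<gamma> * (p + p')"
proof -
  have "(p - p') * (\<delta> + \<gamma> * (p + p')) = 0"
    using assms(1,2) by (simp add: power2_eq_square algebra_simps)
  then show "\<delta> = - \<gamma> * (p + p')"
    using assms(3) by simp
  then show "\<beta> = \<gamma> * (p * p')"
    using assms(1) by algebra
qed

text \<open>Vieta's formula on the three sides gives \<open>\<beta> = \<gamma> p p'\<close>, \<open>\<gamma> = \<alpha> q q'\<close> and
  \<open>\<alpha> = \<beta> r r'\<close>. A vanishing diagonal coefficient would force the other two, and then the mixed
  coefficients, to vanish; so one may go round the cycle and cancel.\<close>

lemma carnot_product:
  fixes \<alpha> \<beta> \<gamma> \<delta> \<epsilon> \<zeta> p q r p' q' r' :: real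
  assumes "\<beta> + \<delta> * p + \<gamma> * p\<^sup>2 = 0" "\<beta> + \<delta> * p' + \<gamma> * p'\<^sup>2 = 0" "p \<noteq> p'"
    and "\<gamma> + \<epsilon> * q + \<alpha> * q\<^sup>2 = 0" "\<gamma> + \<epsilon> * q' + \<alpha> * q'\<^sup>2 = 0" "q \<noteq> q'"
    and "\<alpha> + \<zeta> * r + \<beta> * r\<^sup>2 = 0" "\<alpha> + \<zeta> * r' + \<beta> * r'\<^sup>2 = 0" "r \<noteq> r'"
    and nz: "\<not> (\<alpha> = 0 \<and> \<beta> = 0 \<and> \<gamma> = 0 \<and> \<delta> = 0 \<and> \<epsilon> = 0 \<and> \<zeta> = 0)"
  shows "p * p' * (q * q') * (r * r') = 1"
proof -
  note v = vieta_product[OF assms(1-3)] vieta_product[OF assms(4-6)] vieta_product[OF assms(7-9)]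
  have "\<gamma> \<noteq> 0"
  proof
    assume "\<gamma> = 0"
    then have "\<beta> = 0"
      using v(1) by simp
    then have "\<alpha> = 0"
      using v(5) by simp
    with \<open>\<beta> = 0\<close> \<open>\<gamma> = 0\<close> show False
      using v(2,4,6) nz by simp
  qed
  moreover have "\<gamma> = \<gamma> * (p * p' * (q * q') * (r * r'))"
  proof -
    have "\<gamma> = \<alpha> * (q * q')"
      by (rule v(3))
    also have "\<dots> = \<beta> * (r * r') * (q * q')"
      by (subst v(5)) simp
    also have "\<dots> = \<gamma> * (p * p') * (r * r') * (q * q')"
      by (subst v(1)) simp
    finally show ?thesis
      by (simp add: mult_ac)
  qed
  ultimately show ?thesis
    by simp
qed

text \<open>The three linear factors cut out the cevians. At a vertex of the cevian triangle two of
  them vanish, hence so does each of the three products.\<close>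

definition cevian_conic :: "real \<Rightarrow> real \<Rightarrow> real \<Rightarrow> real \<Rightarrow> real \<Rightarrow> real \<Rightarrow> real \<Rightarrow> real \<Rightarrow> real \<Rightarrow> real"
  where "cevian_conic p q r s t m x y z =
    s * ((z - p * y) * (x - q * z)) + t * ((x - q * z) * (y - r * x))
    + m * ((y - r * x) * (z - p * y))"

lemma cevian_conic_vertices:
  "cevian_conic p q r s t m (p * q) 1 p = 0"
  "cevian_conic p q r s t m q (q * r) 1 = 0"
  "cevian_conic p q r s t m 1 r (r * p) = 0"
  by (simp_all add: cevian_conic_def)

lemma nontrivial_kernel:
  fixes M :: "real^3^3"
  assumes "det M = 0"
  obtains v where "v \<noteq> 0" "M *v v = 0"
  using assms invertible_det_nz[of M] invertible_left_inverse[of M]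
    matrix_left_invertible_ker[of M] by metis

text \<open>The multipliers \<open>s q'\<close>, \<open>t r'\<close>, \<open>m p'\<close> on the left and \<open>s q\<close>, \<open>t r\<close>, \<open>m p\<close> on the right
  make the coefficients of the squares agree. The rows of the matrix in the proof express
  the agreement of the coefficients of \<open>x z\<close>, \<open>x y\<close> and \<open>y z\<close>.\<close>

lemma common_circumconic:
  fixes p q r p' q' r' :: real
  assumes "p * p' * (q * q') * (r * r') = 1"
  obtains s t m where "s \<noteq> 0 \<or> t \<noteq> 0 \<or> m \<noteq> 0"
    and "\<And>x y z. cevian_conic p q r (s * q') (t * r') (m * p') x y z
          = cevian_conic p' q' r' (s * q) (t * r) (m * p) x y z"
proof -
  define M :: "real^3^3" where "M = vector [
    vector [q' - q, - r * r' * (q' - q), - (p' * r - p * r')],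
    vector [- (q' * p - q * p'), r' - r, - p * p' * (r' - r)],
    vector [- q * q' * (p' - p), - (r' * q - r * q'), p' - p]]"
  have "det M = (p' - p) * (q' - q) * (r' - r) * (1 - p * p' * (q * q') * (r * r'))"
    by (simp add: M_def det_3 algebra_simps)
  then have "det M = 0"
    using assms by simp
  then obtain v where v: "v \<noteq> 0" "M *v v = 0"
    using nontrivial_kernel by blast
  define s t m where "s = v$1" "t = v$2" "m = v$3"
  have "s \<noteq> 0 \<or> t \<noteq> 0 \<or> m \<noteq> 0"
    using v(1) by (simp add: s_t_m_def vec_eq_iff forall_3)
  moreover have "cevian_conic p q r (s * q') (t * r') (m * p') x y z
      = cevian_conic p' q' r' (s * q) (t * r) (m * p) x y z" for x y z
  proof -
    have row: "(M *v v) $ i = 0" for i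
      using v(2) by simp
    have xz: "(q' - q) * s - r * r' * (q' - q) * t - (p' * r - p * r') * m = 0"
      and xy: "- (q' * p - q * p') * s + (r' - r) * t - p * p' * (r' - r) * m = 0"
      and yz: "- q * q' * (p' - p) * s - (r' * q - r * q') * t + (p' - p) * m = 0"
      using row[of 1] row[of 2] row[of 3]
      by (simp_all add: matrix_vector_mult_def sum_3 M_def s_t_m_def algebra_simps)
    have "cevian_conic p q r (s * q') (t * r') (m * p') x y z
        - cevian_conic p' q' r' (s * q) (t * r) (m * p) x y z
      = ((q' - q) * s - r * r' * (q' - q) * t - (p' * r - p * r') * m) * (x * z)
        + (- (q' * p - q * p') * s + (r' - r) * t - p * p' * (r' - r) * m) * (x * y)
        + (- q * q' * (p' - p) * s - (r' * q - r * q') * t + (p' - p) * m) * (y * z)"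
      unfolding cevian_conic_def by (simp add: algebra_simps)
    then show ?thesis
      unfolding xz xy yz by simp
  qed
  ultimately show thesis
    using that by blast
qed

text \<open>The coefficient of each square involves only one of the multipliers, and is the value at a
  coordinate vector.\<close>

lemma cevian_conic_nonzero:
  assumes "p \<noteq> 0" "q \<noteq> 0" "r \<noteq> 0" "s \<noteq> 0 \<or> t \<noteq> 0 \<or> m \<noteq> 0"
  obtains x y z where "cevian_conic p q r s t m x y z \<noteq> 0"
proof -
  have "cevian_conic p q r s t m 0 0 1 = - (s * q)" "cevian_conic p q r s t m 1 0 0 = - (t * r)"
    "cevian_conic p q r s t m 0 1 0 = - (m * p)"
    by (simp_all add: cevian_conic_def)
  then show thesis
    using that assms by (metis mult_eq_0_iff neg_equal_0_iff_equal)
qed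

lemma cevian_conic_ternary_quadratic_form:
  assumes "linear (S :: real^3 \<Rightarrow> real^3)"
  shows "ternary_quadratic_form (\<lambda>v. cevian_conic p q r s t m (S v $ 1) (S v $ 2) (S v $ 3))"
proof -
  have lin: "linear (\<lambda>v. k * (S v $ i - l * S v $ j))" for k l i j
    by (rule linearI)
      (simp_all add: linear_add[OF assms] linear_cmul[OF assms] algebra_simps)
  have form: "ternary_quadratic_form
      (\<lambda>v. k * ((S v $ i - l * S v $ j) * (S v $ i' - l' * S v $ j')))" for k l l' i j i' j'
    using ternary_quadratic_form_mult[OF lin[of k i l j] lin[of 1 i' l' j']]
    by (simp add: mult.assoc)
  show ?thesis
    unfolding cevian_conic_def by (intro ternary_quadratic_form_add form)
qed

theorem corollary3p1:
  fixes A B C A1 A2 B1 B2 C1 C2 X1 X2 X3 Y1 Y2 Y3 :: proj_point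
    and K :: "proj_point set"
  assumes "is_triangle A B C"
    and "A1 \<in> line_through B C" and "A2 \<in> line_through B C"
    and "B1 \<in> line_through C A" and "B2 \<in> line_through C A"
    and "C1 \<in> line_through A B" and "C2 \<in> line_through A B"
    and "distinct [A1, A2, B1, B2, C1, C2]"
    and "{A1, A2, B1, B2, C1, C2} \<inter> {A, B, C} = {}"
    and "is_conic K" and "{A1, A2, B1, B2, C1, C2} \<subseteq> K"
    and "X1 = meet A A1 B B1" and "X2 = meet B B1 C C1" and "X3 = meet C C1 A A1"
    and "Y1 = meet A A2 B B2" and "Y2 = meet B B2 C C2" and "Y3 = meet C C2 A A2"
  shows "\<exists>K'. is_conic K' \<and> {X1, X2, X3, Y1, Y2, Y3} \<subseteq> K'"
proof -
  obtain a b c where rep: "represents a A" "represents b B" "represents c C"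
    using representsE by metis
  have ind: "independent3 a b c"
    using triangle_independent assms(1) rep by blast
  obtain S :: "real^3 \<Rightarrow> real^3" where S: "linear S"
    "\<And>x y z. S (x *\<^sub>R a + y *\<^sub>R b + z *\<^sub>R c) = vector [x, y, z]"
    "\<And>v. v = (S v $ 1) *\<^sub>R a + (S v $ 2) *\<^sub>R b + (S v $ 3) *\<^sub>R c"
    using coordinate_map[OF ind] by blast
  obtain p where p: "p \<noteq> 0" "represents (b + p *\<^sub>R c) A1"
    using side_point_parameter[OF rep(2,3) assms(2)] assms(9) by blast
  obtain p' where p': "p' \<noteq> 0" "represents (b + p' *\<^sub>R c) A2"
    using side_point_parameter[OF rep(2,3) assms(3)] assms(9) by blast
  obtain q where q: "q \<noteq> 0" "represents (c + q *\<^sub>R a) B1"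
    using side_point_parameter[OF rep(3,1) assms(4)] assms(9) by blast
  obtain q' where q': "q' \<noteq> 0" "represents (c + q' *\<^sub>R a) B2"
    using side_point_parameter[OF rep(3,1) assms(5)] assms(9) by blast
  obtain r where r: "r \<noteq> 0" "represents (a + r *\<^sub>R b) C1"
    using side_point_parameter[OF rep(1,2) assms(6)] assms(9) by blast
  obtain r' where r': "r' \<noteq> 0" "represents (a + r' *\<^sub>R b) C2"
    using side_point_parameter[OF rep(1,2) assms(7)] assms(9) by blast
  have dist: "p \<noteq> p'" "q \<noteq> q'" "r \<noteq> r'"
    using p p' q q' r r' represents_unique assms(8) by auto

  obtain f where f: "ternary_quadratic_form f" "\<exists>v. f v \<noteq> 0" "K = {P. \<forall>v\<in>hcoords P. f v = 0}"
    using assms(10) unfolding is_conic_def by blast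
  obtain \<alpha> \<beta> \<gamma> \<delta> \<epsilon> \<zeta> where coeffs: "\<And>x y z. f (x *\<^sub>R a + y *\<^sub>R b + z *\<^sub>R c)
      = \<alpha> * x\<^sup>2 + \<beta> * y\<^sup>2 + \<gamma> * z\<^sup>2 + \<delta> * y * z + \<epsilon> * z * x + \<zeta> * x * y"
    using ternary_quadratic_form_on_span[OF f(1)] by blast
  have zero: "f w = 0" if "represents w P" "P \<in> {A1, A2, B1, B2, C1, C2}" for w P
    using represents_in_conic_iff[OF f(1) that(1)] f(3) assms(11) that(2) by auto
  have BC: "f (b + k *\<^sub>R c) = \<beta> + \<delta> * k + \<gamma> * k\<^sup>2" for k
    using coeffs[of 0 1 k] by simp
  have CA: "f (c + k *\<^sub>R a) = \<gamma> + \<epsilon> * k + \<alpha> * k\<^sup>2" for k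
    using coeffs[of k 0 1] by (simp add: add_ac)
  have AB: "f (a + k *\<^sub>R b) = \<alpha> + \<zeta> * k + \<beta> * k\<^sup>2" for k
    using coeffs[of 1 k 0] by simp
  have nz: "\<not> (\<alpha> = 0 \<and> \<beta> = 0 \<and> \<gamma> = 0 \<and> \<delta> = 0 \<and> \<epsilon> = 0 \<and> \<zeta> = 0)"
  proof
    assume "\<alpha> = 0 \<and> \<beta> = 0 \<and> \<gamma> = 0 \<and> \<delta> = 0 \<and> \<epsilon> = 0 \<and> \<zeta> = 0"
    then have "f ((S v $ 1) *\<^sub>R a + (S v $ 2) *\<^sub>R b + (S v $ 3) *\<^sub>R c) = 0" for v
      using coeffs by simp
    then show False
      using f(2) S(3) by metis
  qed
  have carnot: "p * p' * (q * q') * (r * r') = 1"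
  proof (rule carnot_product[OF _ _ dist(1) _ _ dist(2) _ _ dist(3) nz])
    show "\<beta> + \<delta> * p + \<gamma> * p\<^sup>2 = 0" "\<beta> + \<delta> * p' + \<gamma> * p'\<^sup>2 = 0"
      using zero[OF p(2)] zero[OF p'(2)] BC by simp_all
    show "\<gamma> + \<epsilon> * q + \<alpha> * q\<^sup>2 = 0" "\<gamma> + \<epsilon> * q' + \<alpha> * q'\<^sup>2 = 0"
      using zero[OF q(2)] zero[OF q'(2)] CA by simp_all
    show "\<alpha> + \<zeta> * r + \<beta> * r\<^sup>2 = 0" "\<alpha> + \<zeta> * r' + \<beta> * r'\<^sup>2 = 0"
      using zero[OF r(2)] zero[OF r'(2)] AB by simp_all
  qed

  obtain s t m where stm: "s \<noteq> 0 \<or> t \<noteq> 0 \<or> m \<noteq> 0"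
    and common: "\<And>x y z. cevian_conic p q r (s * q') (t * r') (m * p') x y z
          = cevian_conic p' q' r' (s * q) (t * r) (m * p) x y z"
    using common_circumconic[OF carnot] by blast
  define g where "g v = cevian_conic p q r (s * q') (t * r') (m * p') (S v $ 1) (S v $ 2) (S v $ 3)"
    for v
  have g_form: "ternary_quadratic_form g"
    unfolding g_def using cevian_conic_ternary_quadratic_form[OF S(1)] .
  have g: "g (x *\<^sub>R a + y *\<^sub>R b + z *\<^sub>R c) = cevian_conic p q r (s * q') (t * r') (m * p') x y z"
    for x y z
    by (simp add: g_def S(2))
  define K' where "K' = {P. \<forall>v\<in>hcoords P. g v = 0}"
  obtain x y z where "cevian_conic p q r (s * q') (t * r') (m * p') x y z \<noteq> 0"
    using cevian_conic_nonzero[OF p(1) q(1) r(1)] stm p'(1) q'(1) r'(1) by (metis mult_eq_0_iff)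
  then have "\<exists>v. g v \<noteq> 0"
    using g by metis
  then have "is_conic K'"
    unfolding is_conic_def K'_def using g_form by blast
  moreover have on: "P \<in> K'" if "represents w P" "g w = 0" for w P
    using represents_in_conic_iff[OF g_form] that unfolding K'_def by blast
  have "{X1, X2, X3} \<subseteq> K'"
    using cevian_triangle[OF ind rep p(2) q(2) r(2), THEN on] assms(12-14)
    unfolding g by (simp add: cevian_conic_vertices)
  moreover have "{Y1, Y2, Y3} \<subseteq> K'"
    using cevian_triangle[OF ind rep p'(2) q'(2) r'(2), THEN on] assms(15-17)
    unfolding g common by (simp add: cevian_conic_vertices)
  ultimately show ?thesis
    by blast
qed

end
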